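(* Let $H=H(x,u_1,\ldots,u_m,v_1,\ldots,v_m)\in C^2(\Omega\times \mathbb{R}^m_+\times \mathbb{R}^m_+)\cap C(\bar\Omega\times\bar{\mathbb{R}}^m_+\times\bar{\mathbb{R}}^m_+)$ satisfy $$H(x,0,\ldots,0,0,\ldots,0)=0\quad\text{for all }x\in\partial\Omega .$$ Then for any positive solution $(u_1,\ldots,u_m,v_1,\ldots,v_m)$ of the system $$\Delta u_k+H_{v_k}=0 \text{ in }\Omega,\quad u_k=0\text{ on }\partial\Omega,\qquad \Delta v_k+H_{u_k}=0\text{ in }\Omega,\quad v_k=0\text{ on }\partial\Omega,\qquad k=1,\ldots,m,$$ and any real numbers $a_1,\ldots,a_m$, one has $$\int_\Omega\Big[2nH+(2-n)\sum_{k=1}^m\big(a_ku_kH_{u_k}+(2-a_k)v_kH_{v_k}\big)+2\sum_{i=1}^n x_iH_{x_i}\Big]\,dx=2\sum_{k=1}^m\int_{\partial\Omega}(x\cdot\nu)\,|\nabla u_k|\,|\nabla v_k|\,dS .$$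
   Context: $\Omega\subset\mathbb{R}^n$ is a bounded domain whose boundary is smooth enough to have an outward unit normal $\nu$ on $\partial\Omega$ and for the divergence theorem to hold. $m\ge1$ is an integer, $\mathbb{R}_+=(0,\infty)$, $\bar{\mathbb{R}}_+=[0,\infty)$. Subscripts on $H$ denote partial derivatives ($H_{x_i}$ is the derivative with respect to the explicit variable $x_i$), and $H$ and its derivatives are evaluated at $(x,u_1(x),\ldots,u_m(x),v_1(x),\ldots,v_m(x))$. Solutions are classical: all $u_k,v_k\in C^2(\Omega)\cap C^1(\bar\Omega)$. A solution is called positive if $u_k(x)>0$ and $v_k(x)>0$ for all $x\in\Omega$ and all $k$.
   Formalization: The integrand on the left-hand side is additionally assumed to be Lebesgue integrable over Ω; the stated regularity of H and of the solution does not guarantee this, and without it the integral on the left is undefined. *)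

theory Defs
  imports "HOL-Analysis.Analysis"
begin

definition partial :: "'a::real_normed_vector \<Rightarrow> ('a \<Rightarrow> real) \<Rightarrow> 'a \<Rightarrow> real" where
  "partial b f x = deriv (\<lambda>t. f (x + t *\<^sub>R b)) 0"

text \<open>The class \<open>C\<^sup>k(S)\<close>, used for open \<open>S\<close> only.\<close>

primrec Ck_on :: "nat \<Rightarrow> 'a::euclidean_space set \<Rightarrow> ('a \<Rightarrow> real) \<Rightarrow> bool" where
  "Ck_on 0 S f \<longleftrightarrow> continuous_on S f"
| "Ck_on (Suc k) S f \<longleftrightarrow>
     (\<forall>x\<in>S. f differentiable (at x)) \<and> (\<forall>b\<in>Basis. Ck_on k S (partial b f))"

definition grad :: "(real^'n \<Rightarrow> real) \<Rightarrow> real^'n \<Rightarrow> real^'n" where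
  "grad f x = (\<chi> i. partial (axis i 1) f x)"

definition laplacian :: "(real^'n \<Rightarrow> real) \<Rightarrow> real^'n \<Rightarrow> real" where
  "laplacian f x = (\<Sum>i\<in>UNIV. partial (axis i 1) (partial (axis i 1) f) x)"

definition divergence :: "(real^'n \<Rightarrow> real^'n) \<Rightarrow> real^'n \<Rightarrow> real" where
  "divergence F x = (\<Sum>i\<in>UNIV. partial (axis i 1) (\<lambda>y. F y $ i) x)"

text \<open>\<open>f \<in> C\<^sup>1\<close> up to the boundary: \<open>f\<close> is continuous on the closure and its first
  derivatives, which exist and are continuous in \<open>\<Omega>\<close>, extend continuously to the closure.\<close>

definition C1_closure :: "(real^'n) set \<Rightarrow> (real^'n \<Rightarrow> real) \<Rightarrow> bool" where
  "C1_closure \<Omega> f \<longleftrightarrow> Ck_on 1 \<Omega> f \<and> continuous_on (closure \<Omega>) f \<and>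
     (\<exists>g. continuous_on (closure \<Omega>) g \<and> (\<forall>x\<in>\<Omega>. g x = grad f x))"

text \<open>The gradient at a boundary point, i.e. the value there of the continuous extension of the
  gradient. (A function on \<open>real^'n\<close> representing a function on the closure of \<open>\<Omega>\<close> has
  meaningless values outside it, so \<open>grad f x\<close> itself must not be used on the boundary.)\<close>

definition boundary_grad ::
    "(real^'n) set \<Rightarrow> (real^'n \<Rightarrow> real) \<Rightarrow> real^'n \<Rightarrow> real^'n" where
  "boundary_grad \<Omega> f x = Lim (at x within \<Omega>) (grad f)"

text \<open>The \<open>d\<close>-dimensional Hausdorff measure, normalised so that it agrees with surface area
  on \<open>d\<close>-dimensional \<open>C\<^sup>1\<close> surfaces and with the counting measure for \<open>d = 0\<close>.
  Empty covering sets are treated separately because \<open>0 ^ 0 = 1\<close>.\<close>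

definition hausdorff_pre :: "nat \<Rightarrow> real \<Rightarrow> 'a::metric_space set \<Rightarrow> ennreal" where
  "hausdorff_pre d \<delta> A =
     (INF E \<in> {E :: nat \<Rightarrow> 'a set. A \<subseteq> (\<Union>i. E i) \<and>
                 (\<forall>i. bounded (E i) \<and> diameter (E i) \<le> \<delta>)}.
        \<Sum>i. if E i = {} then 0
             else ennreal (unit_ball_vol (real d) * (diameter (E i) / 2) ^ d))"

definition hausdorff_outer :: "nat \<Rightarrow> 'a::metric_space set \<Rightarrow> ennreal" where
  "hausdorff_outer d A = (SUP \<delta> \<in> {0<..}. hausdorff_pre d \<delta> A)"

text \<open>\<open>hausdorff_outer d\<close> is a metric outer measure, hence countably additive on the Borel
  sets by Caratheodory's criterion.\<close>

definition hausdorff_measure :: "nat \<Rightarrow> 'a::metric_space measure" where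
  "hausdorff_measure d = measure_of UNIV (sets borel) (hausdorff_outer d)"

definition surface_measure :: "(real^'n) measure" where
  "surface_measure = hausdorff_measure (CARD('n) - 1)"

text \<open>\<open>\<nu>\<close> is the outward unit normal at the boundary point \<open>p\<close>: along every ray from \<open>p\<close>
  pointing to the open half-space \<open>{d. d \<bullet> \<nu> < 0}\<close> one enters \<open>\<Omega>\<close>, along every ray
  pointing to the opposite one one leaves the closure of \<open>\<Omega>\<close>. Such a \<open>\<nu>\<close> is unique. If
  near \<open>p\<close> the set \<open>\<Omega>\<close> is \<open>{\<phi> < 0}\<close> with \<open>\<phi>\<close> a \<open>C\<^sup>1\<close> function, \<open>\<phi> p = 0\<close> and nonvanishing
  gradient at \<open>p\<close>, then it is the normalised gradient of \<open>\<phi>\<close> at \<open>p\<close>.\<close>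

definition outward_unit_normal :: "(real^'n) set \<Rightarrow> real^'n \<Rightarrow> real^'n \<Rightarrow> bool" where
  "outward_unit_normal \<Omega> p \<nu> \<longleftrightarrow> norm \<nu> = 1 \<and>
     (\<forall>d. d \<bullet> \<nu> < 0 \<longrightarrow> (\<forall>\<^sub>F t in at_right 0. p + t *\<^sub>R d \<in> \<Omega>)) \<and>
     (\<forall>d. d \<bullet> \<nu> > 0 \<longrightarrow> (\<forall>\<^sub>F t in at_right 0. p + t *\<^sub>R d \<notin> closure \<Omega>))"

text \<open>The divergence theorem on \<open>\<Omega>\<close> with normal field \<open>\<nu>\<close>, for vector fields that are continuous
  on the closure and \<open>C\<^sup>1\<close> in the interior, with integrable divergence. It holds for every
  bounded domain with \<open>C\<^sup>1\<close> boundary.\<close>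

definition divergence_theorem_holds ::
    "(real^'n) set \<Rightarrow> (real^'n \<Rightarrow> real^'n) \<Rightarrow> bool" where
  "divergence_theorem_holds \<Omega> \<nu> \<longleftrightarrow>
     (\<forall>F. continuous_on (closure \<Omega>) F \<and> (\<forall>i. Ck_on 1 \<Omega> (\<lambda>x. F x $ i)) \<and>
          set_integrable lborel \<Omega> (divergence F) \<longrightarrow>
          (LINT x:\<Omega>|lborel. divergence F x) =
          (LINT x:frontier \<Omega>|surface_measure. F x \<bullet> \<nu> x))"

text \<open>The Hamiltonian is a function of the triple \<open>(x, u, v)\<close>.\<close>

definition positive_orthant :: "(real^'m) set" where
  "positive_orthant = {a. \<forall>k. a $ k > 0}"

definition nonneg_orthant :: "(real^'m) set" where
  "nonneg_orthant = {a. \<forall>k. a $ k \<ge> 0}"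

definition D_x :: "'n::finite \<Rightarrow> ((real^'n) \<times> (real^'m) \<times> (real^'m) \<Rightarrow> real)
    \<Rightarrow> (real^'n) \<times> (real^'m) \<times> (real^'m) \<Rightarrow> real" where
  "D_x i H = partial (axis i 1, 0, 0) H"

definition D_u :: "'m::finite \<Rightarrow> ((real^'n) \<times> (real^'m) \<times> (real^'m) \<Rightarrow> real)
    \<Rightarrow> (real^'n) \<times> (real^'m) \<times> (real^'m) \<Rightarrow> real" where
  "D_u k H = partial (0, axis k 1, 0) H"

definition D_v :: "'m::finite \<Rightarrow> ((real^'n) \<times> (real^'m) \<times> (real^'m) \<Rightarrow> real)
    \<Rightarrow> (real^'n) \<times> (real^'m) \<times> (real^'m) \<Rightarrow> real" where
  "D_v k H = partial (0, 0, axis k 1) H"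

definition state :: "('m \<Rightarrow> real^'n \<Rightarrow> real) \<Rightarrow> ('m \<Rightarrow> real^'n \<Rightarrow> real)
    \<Rightarrow> real^'n \<Rightarrow> (real^'n) \<times> (real^'m) \<times> (real^'m)" where
  "state u v x = (x, (\<chi> k. u k x), (\<chi> k. v k x))"

definition classical_solution :: "(real^'n) set \<Rightarrow> ((real^'n) \<times> (real^'m) \<times> (real^'m) \<Rightarrow> real)
    \<Rightarrow> ('m::finite \<Rightarrow> real^'n \<Rightarrow> real) \<Rightarrow> ('m \<Rightarrow> real^'n \<Rightarrow> real) \<Rightarrow> bool" where
  "classical_solution \<Omega> H u v \<longleftrightarrow>
     (\<forall>k. Ck_on 2 \<Omega> (u k) \<and> C1_closure \<Omega> (u k) \<and> Ck_on 2 \<Omega> (v k) \<and> C1_closure \<Omega> (v k) \<and>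
          (\<forall>x\<in>\<Omega>. laplacian (u k) x + D_v k H (state u v x) = 0) \<and>
          (\<forall>x\<in>frontier \<Omega>. u k x = 0) \<and>
          (\<forall>x\<in>\<Omega>. laplacian (v k) x + D_u k H (state u v x) = 0) \<and>
          (\<forall>x\<in>frontier \<Omega>. v k x = 0))"

definition positive_on :: "'a set \<Rightarrow> ('m \<Rightarrow> 'a \<Rightarrow> real) \<Rightarrow> ('m \<Rightarrow> 'a \<Rightarrow> real) \<Rightarrow> bool" where
  "positive_on \<Omega> u v \<longleftrightarrow> (\<forall>k. \<forall>x\<in>\<Omega>. u k x > 0 \<and> v k x > 0)"

end

theory Submission
  imports Defs
begin

text \<open>
  The identity is the divergence theorem for one vector field. For two functions \<open>f\<close>, \<open>g\<close> the
  field \<open>(x \<bullet> \<nabla>f) \<nabla>g + (x \<bullet> \<nabla>g) \<nabla>f - (\<nabla>f \<bullet> \<nabla>g) x\<close> has the divergence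
  \<open>(2 - n) \<nabla>f \<bullet> \<nabla>g + (x \<bullet> \<nabla>f) \<Delta>g + (x \<bullet> \<nabla>g) \<Delta>f\<close> (\<open>divergence_pohozaev_field\<close>), since the terms
  with other second derivatives cancel by Schwarz's theorem (\<open>partial_commute\<close>). Let \<open>f = u\<^sub>k\<close>,
  \<open>g = v\<^sub>k\<close>, sum over \<open>k\<close> and add \<open>H x\<close>. By the equations, the derivatives of \<open>H\<close> through \<open>u\<close> and \<open>v\<close>
  cancel the terms with Laplacians, and \<open>n H + x \<bullet> H\<^sub>x + (2 - n) \<Sum>\<^sub>k \<nabla>u\<^sub>k \<bullet> \<nabla>v\<^sub>k\<close> remains. The last sum is
  traded for terms without gradients by means of
  \<open>a\<^sub>k u\<^sub>k \<nabla>v\<^sub>k + (2 - a\<^sub>k) v\<^sub>k \<nabla>u\<^sub>k\<close>, whose divergence is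
  \<open>2 \<nabla>u\<^sub>k \<bullet> \<nabla>v\<^sub>k - a\<^sub>k u\<^sub>k H\<^sub>u\<^sub>k - (2 - a\<^sub>k) v\<^sub>k H\<^sub>v\<^sub>k\<close>. The combination of these fields that has
  the desired integrand as its divergence is \<open>hamiltonian_field\<close>.

  On the boundary \<open>u\<close>, \<open>v\<close> and \<open>H\<close> vanish. As the solution is positive inside, the gradients of
  \<open>u\<^sub>k\<close> and \<open>v\<^sub>k\<close> are nonpositive multiples of the outward normal there
  (\<open>extended_grad_at_boundary\<close>), so the flux density of each Pohozaev field is
  \<open>(x \<bullet> \<nu>) \<bar>\<nabla>u\<^sub>k\<bar> \<bar>\<nabla>v\<^sub>k\<bar>\<close>.

  To split the flux of the sum into the sum of the fluxes, each of these functions must be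
  integrable over the boundary. This reduces to the integrability of the components of \<open>\<nu>\<close>, which
  is a consequence of the divergence theorem for the fields \<open>x - b\<close>
  (\<open>set_integrable_normal_component\<close>).

  The gradients of functions that are \<open>C\<^sup>1\<close> up to the boundary have two guises: the derivative inside
  \<open>\<Omega>\<close>, and a continuous extension to the closure. The fields are therefore defined for arbitrary
  vector fields in place of the gradients; divergences are computed for the former, and continuity
  and fluxes for the latter.
\<close>

section \<open>Partial derivatives and continuously differentiable functions\<close>

lemma partial_eq:
  assumes "(f has_derivative f') (at x)"
  shows "partial b f x = f' b"
proof -
  interpret f': bounded_linear f'
    using assms by (rule has_derivative_bounded_linear)
  have "((\<lambda>t. f (x + t *\<^sub>R b)) has_derivative (\<lambda>t. f' (t *\<^sub>R b))) (at 0)"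
    by (rule has_derivative_compose[where g = f and f = "\<lambda>t. x + t *\<^sub>R b"])
      (use assms in \<open>auto intro!: derivative_eq_intros\<close>)
  then have "((\<lambda>t. f (x + t *\<^sub>R b)) has_real_derivative f' b) (at 0)"
    unfolding has_field_derivative_def by (simp add: f'.scaleR mult.commute[of _ "f' b"])
  then show ?thesis
    unfolding partial_def by (rule DERIV_imp_deriv)
qed

text \<open>The mean value theorem is applied to restrictions to lines, both for the symmetry of the
  second derivatives and at the boundary; this is the derivative that it needs.\<close>

lemma DERIV_along_line:
  assumes "f differentiable (at (x + t *\<^sub>R b))"
  shows "((\<lambda>s. f (x + s *\<^sub>R b)) has_real_derivative partial b f (x + t *\<^sub>R b)) (at t)"
proof -
  obtain f' where f': "(f has_derivative f') (at (x + t *\<^sub>R b))"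
    using assms unfolding differentiable_def by blast
  then interpret f': bounded_linear f'
    by (rule has_derivative_bounded_linear)
  have "((\<lambda>s. f (x + s *\<^sub>R b)) has_derivative (\<lambda>s. f' (s *\<^sub>R b))) (at t)"
    by (rule has_derivative_compose[where g = f and f = "\<lambda>t. x + t *\<^sub>R b"])
      (use f' in \<open>auto intro!: derivative_eq_intros\<close>)
  then show ?thesis
    unfolding has_field_derivative_def partial_eq[OF f']
    by (simp add: f'.scaleR mult.commute[of _ "f' b"])
qed

text \<open>The extended gradients used below agree with the true ones only on the open set \<open>\<Omega>\<close>. This
  lemma and the two after it let differential properties pass from one to the other.\<close>

lemma has_derivative_eq_transform_open:
  assumes "open S" "x \<in> S" "\<And>y. y \<in> S \<Longrightarrow> f y = g y"
  shows "(f has_derivative f') (at x) \<longleftrightarrow> (g has_derivative f') (at x)"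
  using has_derivative_transform_within_open[of f f' x UNIV S g]
    has_derivative_transform_within_open[of g f' x UNIV S f] assms by auto

lemma partial_cong_open:
  assumes "open S" "x \<in> S" "\<And>y. y \<in> S \<Longrightarrow> f y = g y"
  shows "partial b f x = partial b g x"
proof -
  have "((\<lambda>t. x + t *\<^sub>R b) \<longlongrightarrow> x + 0 *\<^sub>R b) (nhds 0)"
    by (intro tendsto_intros filterlim_ident)
  then have "\<forall>\<^sub>F t in nhds 0. x + t *\<^sub>R b \<in> S"
    using assms(1,2) by (auto dest: topological_tendstoD)
  then show ?thesis
    unfolding partial_def using assms(3)
    by (intro deriv_cong_ev) (auto elim: eventually_mono)
qed

lemma Ck_on_cong:
  assumes "open S" "\<And>y. y \<in> S \<Longrightarrow> f y = g y" "Ck_on k S f"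
  shows "Ck_on k S g"
  using assms(2,3)
proof (induction k arbitrary: f g)
  case 0
  then show ?case by (metis Ck_on.simps(1) continuous_on_cong)
next
  case (Suc k)
  have "g differentiable (at x)" if "x \<in> S" for x
    using Suc.prems that has_derivative_eq_transform_open[OF \<open>open S\<close> that, of f g]
    unfolding Ck_on.simps differentiable_def by blast
  moreover have "Ck_on k S (partial b g)" if "b \<in> Basis" for b
  proof (rule Suc.IH)
    show "partial b f y = partial b g y" if "y \<in> S" for y
      using partial_cong_open[OF \<open>open S\<close> that Suc.prems(1)] .
    show "Ck_on k S (partial b f)" using Suc.prems(2) that by simp
  qed
  ultimately show ?case by simp
qed

lemma Ck_1_iff:
  "Ck_on 1 S f \<longleftrightarrow>
    (\<forall>x\<in>S. f differentiable (at x)) \<and> (\<forall>b\<in>Basis. continuous_on S (partial b f))"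
  by simp

lemma Ck_2_iff:
  "Ck_on 2 S f \<longleftrightarrow>
    (\<forall>x\<in>S. f differentiable (at x)) \<and> (\<forall>b\<in>Basis. Ck_on 1 S (partial b f))"
  by (simp add: numeral_2_eq_2)

text \<open>The partial derivatives that define the class are values of the Frechet derivative. With the
  latter, closure under the algebraic operations is read off from the differentiation rules.\<close>

lemma Ck_1I:
  assumes "\<And>x. x \<in> S \<Longrightarrow> (f has_derivative f' x) (at x)"
    and "\<And>b. b \<in> Basis \<Longrightarrow> continuous_on S (\<lambda>x. f' x b)"
  shows "Ck_on 1 S f"
  unfolding Ck_1_iff
proof (intro conjI ballI)
  show "f differentiable (at x)" if "x \<in> S" for x
    using assms(1)[OF that] by (auto simp: differentiable_def)
  show "continuous_on S (partial b f)" if "b \<in> Basis" for b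
    using assms(2)[OF that] partial_eq[OF assms(1)] by (auto cong: continuous_on_cong)
qed

lemma Ck_1E:
  assumes "Ck_on 1 S f"
  obtains f' where "\<And>x. x \<in> S \<Longrightarrow> (f has_derivative f' x) (at x)"
    and "\<And>b. b \<in> Basis \<Longrightarrow> continuous_on S (\<lambda>x. f' x b)"
proof -
  have "\<forall>x\<in>S. \<exists>D. (f has_derivative D) (at x)"
    using assms unfolding Ck_1_iff differentiable_def by blast
  then obtain f' where f': "\<And>x. x \<in> S \<Longrightarrow> (f has_derivative f' x) (at x)"
    by metis
  have "continuous_on S (\<lambda>x. f' x b)" if "b \<in> Basis" for b
    using assms that partial_eq[OF f'] unfolding Ck_1_iff
    by (metis (mono_tags, lifting) continuous_on_cong)
  with f' that show ?thesis by blast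
qed

lemma Ck_1_continuous: "Ck_on 1 S f \<Longrightarrow> continuous_on S f"
  unfolding Ck_1_iff
  by (meson continuous_at_imp_continuous_on differentiable_imp_continuous_within)

lemma Ck_2_imp_1: "Ck_on 2 S f \<Longrightarrow> Ck_on 1 S f"
  using Ck_1_continuous unfolding Ck_1_iff Ck_2_iff by blast

lemma Ck_1_const: "Ck_on 1 S (\<lambda>x. c)"
  by (rule Ck_1I[where f' = "\<lambda>x h. 0"]) auto

lemma Ck_1_nth: "Ck_on 1 S (\<lambda>x. x $ i)"
  by (rule Ck_1I[where f' = "\<lambda>x h. h $ i"])
    (auto intro: bounded_linear_imp_has_derivative)

lemma Ck_1_add: "Ck_on 1 S f \<Longrightarrow> Ck_on 1 S g \<Longrightarrow> Ck_on 1 S (\<lambda>x. f x + g x)"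
  by (elim Ck_1E, rule Ck_1I) (auto intro: has_derivative_add continuous_on_add)

lemma Ck_1_diff: "Ck_on 1 S f \<Longrightarrow> Ck_on 1 S g \<Longrightarrow> Ck_on 1 S (\<lambda>x. f x - g x)"
  by (elim Ck_1E, rule Ck_1I) (auto intro: has_derivative_diff continuous_on_diff)

lemma Ck_1_mult:
  assumes "Ck_on 1 S f" "Ck_on 1 S g"
  shows "Ck_on 1 S (\<lambda>x. f x * g x)"
proof -
  note cont = assms[THEN Ck_1_continuous]
  show ?thesis
    by (rule Ck_1E[OF assms(1)], rule Ck_1E[OF assms(2)], rule Ck_1I)
      (auto intro!: has_derivative_mult continuous_intros cont)
qed

lemma Ck_1_sum: "(\<And>k. k \<in> K \<Longrightarrow> Ck_on 1 S (f k)) \<Longrightarrow> Ck_on 1 S (\<lambda>x. \<Sum>k\<in>K. f k x)"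
  by (induction K rule: infinite_finite_induct) (simp_all add: Ck_1_const Ck_1_add del: One_nat_def)

lemmas Ck_1_intros = Ck_1_const Ck_1_nth Ck_1_add Ck_1_diff Ck_1_mult Ck_1_sum

section \<open>Symmetry of the second derivatives\<close>

text \<open>The mean value theorem is applied first to the increment of \<open>f\<close> over \<open>h c\<close> as a function of
  the coefficient of \<open>b\<close>, then to \<open>partial b f\<close> in direction \<open>c\<close>. The left-hand side is symmetric
  in \<open>b\<close> and \<open>c\<close>, and this is where the symmetry of the second derivatives comes from.\<close>

lemma second_difference_eq_partial:
  fixes f :: "'a::euclidean_space \<Rightarrow> real"
  assumes C2: "Ck_on 2 S f" and b: "b \<in> Basis" and c: "c \<in> Basis"
    and S: "ball x (3 * h) \<subseteq> S" and h: "0 < h"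
  obtains y where "dist x y < 3 * h"
    and "f (x + h *\<^sub>R b + h *\<^sub>R c) - f (x + h *\<^sub>R b) - f (x + h *\<^sub>R c) + f x
      = h * (h * partial c (partial b f) y)"
proof -
  have near: "dist x (x + s *\<^sub>R b + t *\<^sub>R c) < 3 * h" if "0 \<le> s" "s \<le> h" "0 \<le> t" "t \<le> h" for s t
  proof -
    have "dist x (x + s *\<^sub>R b + t *\<^sub>R c) = norm (s *\<^sub>R b + t *\<^sub>R c)"
      by (metis add.assoc add_diff_cancel_left' dist_commute dist_norm)
    also have "\<dots> \<le> norm (s *\<^sub>R b) + norm (t *\<^sub>R c)" by (rule norm_triangle_ineq)
    also have "\<dots> < 3 * h" using that h b c by simp
    finally show ?thesis .
  qed
  have in_S: "x + s *\<^sub>R b + t *\<^sub>R c \<in> S" if "0 \<le> s" "s \<le> h" "0 \<le> t" "t \<le> h" for s t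
    using near[OF that] S by auto
  have df: "f differentiable (at y)" if "y \<in> S" for y
    using C2 that unfolding Ck_2_iff by blast
  have dfb: "partial b f differentiable (at y)" if "y \<in> S" for y
    using C2 that b unfolding Ck_2_iff Ck_1_iff by blast
  let ?\<phi> = "\<lambda>s. f ((x + h *\<^sub>R c) + s *\<^sub>R b) - f (x + s *\<^sub>R b)"
  have "\<exists>s>0. s < h \<and> ?\<phi> h - ?\<phi> 0 = (h - 0) *
     (partial b f ((x + h *\<^sub>R c) + s *\<^sub>R b) - partial b f (x + s *\<^sub>R b))"
  proof (rule MVT2[OF h])
    fix s assume s: "0 \<le> s" "s \<le> h"
    show "DERIV ?\<phi> s :> partial b f ((x + h *\<^sub>R c) + s *\<^sub>R b) - partial b f (x + s *\<^sub>R b)"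
      using in_S[OF s, of h] in_S[OF s, of 0] h
      by (intro DERIV_diff DERIV_along_line df) (auto simp: algebra_simps)
  qed
  then obtain s where s: "0 < s" "s < h"
    and eq1: "?\<phi> h - ?\<phi> 0 = h *
      (partial b f ((x + s *\<^sub>R b) + h *\<^sub>R c) - partial b f ((x + s *\<^sub>R b) + 0 *\<^sub>R c))"
    by (auto simp: algebra_simps)
  have "\<exists>t>0. t < h \<and> partial b f ((x + s *\<^sub>R b) + h *\<^sub>R c) - partial b f ((x + s *\<^sub>R b) + 0 *\<^sub>R c)
     = (h - 0) * partial c (partial b f) ((x + s *\<^sub>R b) + t *\<^sub>R c)"
    using in_S s by (intro MVT2[OF h] DERIV_along_line dfb) auto
  then obtain t where t: "0 < t" "t < h"
    and eq2: "partial b f ((x + s *\<^sub>R b) + h *\<^sub>R c) - partial b f ((x + s *\<^sub>R b) + 0 *\<^sub>R c)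
     = h * partial c (partial b f) ((x + s *\<^sub>R b) + t *\<^sub>R c)"
    by auto
  show ?thesis
  proof (rule that)
    show "dist x (x + s *\<^sub>R b + t *\<^sub>R c) < 3 * h" using near s t by simp
    show "f (x + h *\<^sub>R b + h *\<^sub>R c) - f (x + h *\<^sub>R b) - f (x + h *\<^sub>R c) + f x
      = h * (h * partial c (partial b f) (x + s *\<^sub>R b + t *\<^sub>R c))"
      using eq1 unfolding eq2 by (simp add: algebra_simps)
  qed
qed

text \<open>Schwarz's theorem. Evaluating the symmetric second difference in both orders shows that the
  two mixed derivatives take a common value at points arbitrarily close to \<open>x\<close>; both are
  continuous there.\<close>

lemma partial_commute:
  fixes f :: "'a::euclidean_space \<Rightarrow> real"
  assumes C2: "Ck_on 2 S f" and S: "open S" "x \<in> S" and b: "b \<in> Basis" and c: "c \<in> Basis"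
  shows "partial b (partial c f) x = partial c (partial b f) x"
proof (rule ccontr)
  let ?p = "partial b (partial c f)" and ?q = "partial c (partial b f)"
  assume neq: "?p x \<noteq> ?q x"
  define e where "e = dist (?p x) (?q x) / 2"
  have e: "e > 0" using neq by (simp add: e_def)
  have "isCont ?p x" "isCont ?q x"
    using C2 S b c unfolding Ck_2_iff Ck_1_iff by (auto simp: continuous_on_eq_continuous_at)
  then obtain d1 d2 where d1: "d1 > 0" "\<And>y. dist y x < d1 \<Longrightarrow> dist (?p y) (?p x) < e"
    and d2: "d2 > 0" "\<And>y. dist y x < d2 \<Longrightarrow> dist (?q y) (?q x) < e"
    using e unfolding continuous_at_eps_delta dist_norm by metis
  obtain r where r: "r > 0" "ball x r \<subseteq> S"
    using S by (auto simp: open_contains_ball)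
  define h where "h = min r (min d1 d2) / 3"
  have h: "h > 0" "3 * h \<le> r" "3 * h \<le> d1" "3 * h \<le> d2"
    using r d1 d2 by (auto simp: h_def)
  have ball: "ball x (3 * h) \<subseteq> S" using r h by (auto simp: subset_iff)
  obtain y where y: "dist x y < 3 * h"
    and eqy: "f (x + h *\<^sub>R b + h *\<^sub>R c) - f (x + h *\<^sub>R b) - f (x + h *\<^sub>R c) + f x = h * (h * ?q y)"
    using second_difference_eq_partial[OF C2 b c ball h(1)] .
  obtain z where z: "dist x z < 3 * h"
    and eqz: "f (x + h *\<^sub>R c + h *\<^sub>R b) - f (x + h *\<^sub>R c) - f (x + h *\<^sub>R b) + f x = h * (h * ?p z)"
    using second_difference_eq_partial[OF C2 c b ball h(1)] .
  have "h * (h * ?q y) = h * (h * ?p z)"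
    using eqy eqz by (simp add: algebra_simps)
  then have "?q y = ?p z" using h(1) by simp
  moreover have "dist (?p z) (?p x) < e" using z h d1(2)[of z] by (simp add: dist_commute)
  moreover have "dist (?q y) (?q x) < e" using y h d2(2)[of y] by (simp add: dist_commute)
  ultimately have "dist (?p z) (?p x) + dist (?p z) (?q x) < 2 * e" by simp
  then show False
    using dist_triangle3[of "?p x" "?q x" "?p z"] by (simp add: e_def)
qed

section \<open>Gradient and divergence calculus\<close>

lemma grad_eq:
  assumes "(f has_derivative f') (at x)"
  shows "grad f x = (\<chi> i. f' (axis i 1))"
  by (simp add: grad_def partial_eq[OF assms])

lemma linear_vec_expansion:
  fixes f :: "real^'n \<Rightarrow> 'b::real_vector"
  assumes "linear f"
  shows "f h = (\<Sum>i\<in>UNIV. (h $ i) *\<^sub>R f (axis i 1))"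
proof -
  have "f h = f (\<Sum>i\<in>UNIV. (h $ i) *\<^sub>R axis i 1)"
    using basis_expansion[of h] by (simp add: scalar_mult_eq_scaleR)
  also have "\<dots> = (\<Sum>i\<in>UNIV. (h $ i) *\<^sub>R f (axis i 1))"
    by (simp add: linear_sum[OF assms] linear_scale[OF assms])
  finally show ?thesis .
qed

lemma has_derivative_grad:
  assumes "f differentiable (at x)"
  shows "(f has_derivative (\<lambda>h. grad f x \<bullet> h)) (at x)"
proof -
  obtain f' where f': "(f has_derivative f') (at x)"
    using assms by (auto simp: differentiable_def)
  then have "linear f'" by (rule has_derivative_linear)
  then have "f' h = grad f x \<bullet> h" for h
    by (subst linear_vec_expansion[of f']) (simp_all add: grad_eq[OF f'] inner_vec_def mult.commute)
  then have "f' = (\<lambda>h. grad f x \<bullet> h)" by (rule ext)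
  with f' show ?thesis by simp
qed

lemma divergence_eq:
  assumes "(F has_derivative F') (at x)"
  shows "divergence F x = (\<Sum>i\<in>UNIV. F' (axis i 1) $ i)"
proof -
  have "((\<lambda>y. F y $ i) has_derivative (\<lambda>h. F' h $ i)) (at x)" for i
    using assms by (rule bounded_linear.has_derivative[OF bounded_linear_vec_nth])
  from partial_eq[OF this] show ?thesis
    by (simp add: divergence_def)
qed

lemma divergence_cong_open:
  assumes "open S" "x \<in> S" "\<And>y. y \<in> S \<Longrightarrow> F y = G y"
  shows "divergence F x = divergence G x"
  unfolding divergence_def using assms by (intro sum.cong partial_cong_open) auto

lemma divergence_add:
  assumes "F differentiable (at x)" "G differentiable (at x)"
  shows "divergence (\<lambda>y. F y + G y) x = divergence F x + divergence G x"
proof -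
  from assms obtain F' G' where d: "(F has_derivative F') (at x)" "(G has_derivative G') (at x)"
    by (auto simp: differentiable_def)
  show ?thesis
    by (simp add: divergence_eq[OF has_derivative_add[OF d]] d[THEN divergence_eq] sum.distrib)
qed

lemma divergence_diff:
  assumes "F differentiable (at x)" "G differentiable (at x)"
  shows "divergence (\<lambda>y. F y - G y) x = divergence F x - divergence G x"
proof -
  from assms obtain F' G' where d: "(F has_derivative F') (at x)" "(G has_derivative G') (at x)"
    by (auto simp: differentiable_def)
  show ?thesis
    by (simp add: divergence_eq[OF has_derivative_diff[OF d]] d[THEN divergence_eq] sum_subtractf)
qed

lemma divergence_scaleR:
  assumes "f differentiable (at x)" "G differentiable (at x)"
  shows "divergence (\<lambda>y. f y *\<^sub>R G y) x = f x * divergence G x + grad f x \<bullet> G x"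
proof -
  from assms obtain f' G' where d: "(f has_derivative f') (at x)" "(G has_derivative G') (at x)"
    by (auto simp: differentiable_def)
  show ?thesis
    by (simp add: divergence_eq[OF has_derivative_scaleR[OF d]] divergence_eq[OF d(2)]
        grad_eq[OF d(1)] inner_vec_def sum.distrib sum_distrib_left)
qed

lemma divergence_const_scaleR:
  assumes "G differentiable (at x)"
  shows "divergence (\<lambda>y. c *\<^sub>R G y) x = c * divergence G x"
  using divergence_scaleR[of "\<lambda>_. c" x G] assms grad_eq[of "\<lambda>_. c" "\<lambda>_. 0" x]
  by (simp add: inner_vec_def)

lemma divergence_sum:
  assumes "\<And>k. k \<in> K \<Longrightarrow> F k differentiable (at x)"
  shows "divergence (\<lambda>y. \<Sum>k\<in>K. F k y) x = (\<Sum>k\<in>K. divergence (F k) x)"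
proof -
  have "\<forall>k\<in>K. \<exists>D. (F k has_derivative D) (at x)"
    using assms by (auto simp: differentiable_def)
  then obtain D where D: "\<And>k. k \<in> K \<Longrightarrow> (F k has_derivative D k) (at x)"
    by metis
  have "divergence (\<lambda>y. \<Sum>k\<in>K. F k y) x = (\<Sum>i\<in>UNIV. \<Sum>k\<in>K. D k (axis i 1) $ i)"
    by (subst divergence_eq[OF has_derivative_sum[OF D]]) simp_all
  also have "\<dots> = (\<Sum>k\<in>K. divergence (F k) x)"
    by (subst sum.swap) (simp add: divergence_eq[OF D])
  finally show ?thesis .
qed

lemma divergence_ident_diff: "divergence (\<lambda>y::real^'n. y - c) x = real CARD('n)"
proof -
  have "((\<lambda>y::real^'n. y - c) has_derivative (\<lambda>h. h)) (at x)"
    by (auto intro!: derivative_eq_intros)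
  then show ?thesis by (simp add: divergence_eq axis_def)
qed

lemma divergence_ident: "divergence (\<lambda>y::real^'n. y) x = real CARD('n)"
  using divergence_ident_diff[of 0] by simp

lemma divergence_grad: "divergence (grad f) x = laplacian f x"
  by (simp add: divergence_def laplacian_def grad_def)

section \<open>The Pohozaev field\<close>

text \<open>The Hessian as an operator rather than a matrix, since only its action on vectors occurs.\<close>

definition hess :: "(real^'n \<Rightarrow> real) \<Rightarrow> real^'n \<Rightarrow> real^'n \<Rightarrow> real^'n" where
  "hess f x h = (\<chi> i. grad (partial (axis i 1) f) x \<bullet> h)"

lemma has_derivative_grad_hess:
  assumes "Ck_on 2 S f" "x \<in> S"
  shows "(grad f has_derivative hess f x) (at x)"
proof -
  have "((\<lambda>y. grad f y \<bullet> b) has_derivative (\<lambda>h. hess f x h \<bullet> b)) (at x)" if Basis: "b \<in> Basis" for b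
  proof -
    obtain i where b: "b = axis i 1" using Basis unfolding Basis_vec_def by auto
    have "partial b f differentiable (at x)"
      using assms Basis unfolding Ck_2_iff Ck_1_iff by blast
    then show ?thesis
      using has_derivative_grad by (simp add: b inner_axis grad_def[of f] hess_def)
  qed
  then show ?thesis by (subst has_derivative_componentwise_within) simp
qed

text \<open>Because of this symmetry only the Laplacians survive of the second derivatives in the
  divergence of the Pohozaev field.\<close>

lemma hess_symmetric:
  assumes "Ck_on 2 S f" "open S" "x \<in> S"
  shows "hess f x y \<bullet> z = hess f x z \<bullet> y"
proof -
  have sym: "partial (axis i 1) (partial (axis j 1) f) x = partial (axis j 1) (partial (axis i 1) f) x"
    for i j :: 'a
    using assms by (intro partial_commute) auto
  have "hess f x y \<bullet> z =
      (\<Sum>i\<in>UNIV. \<Sum>j\<in>UNIV. partial (axis j 1) (partial (axis i 1) f) x * y $ j * z $ i)"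
    by (simp add: hess_def grad_def inner_vec_def sum_distrib_right)
  also have "\<dots> = (\<Sum>j\<in>UNIV. \<Sum>i\<in>UNIV. partial (axis j 1) (partial (axis i 1) f) x * y $ j * z $ i)"
    by (rule sum.swap)
  also have "\<dots> = (\<Sum>j\<in>UNIV. \<Sum>i\<in>UNIV. partial (axis i 1) (partial (axis j 1) f) x * z $ i * y $ j)"
    by (intro sum.cong refl) (simp add: sym mult_ac)
  also have "\<dots> = hess f x z \<bullet> y"
    by (simp add: hess_def grad_def inner_vec_def sum_distrib_right)
  finally show ?thesis .
qed

text \<open>The polarised form of the field \<open>2 (x \<bullet> \<nabla>f) \<nabla>f - \<bar>\<nabla>f\<bar>\<^sup>2 x\<close> of Rellich and Pohozaev. The
  gradients are replaced by arbitrary fields, so that on the closure of \<open>\<Omega>\<close> their continuous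
  extensions can be inserted.\<close>

definition pohozaev_field ::
    "(real^'n \<Rightarrow> real^'n) \<Rightarrow> (real^'n \<Rightarrow> real^'n) \<Rightarrow> real^'n \<Rightarrow> real^'n" where
  "pohozaev_field G K x = (x \<bullet> G x) *\<^sub>R K x + (x \<bullet> K x) *\<^sub>R G x - (G x \<bullet> K x) *\<^sub>R x"

lemma grad_inner_dot:
  assumes "(F has_derivative F') (at x)" "(G has_derivative G') (at x)"
  shows "grad (\<lambda>y. F y \<bullet> G y) x \<bullet> w = F' w \<bullet> G x + F x \<bullet> G' w"
proof -
  have d: "((\<lambda>y. F y \<bullet> G y) has_derivative (\<lambda>h. F x \<bullet> G' h + F' h \<bullet> G x)) (at x)"
    using assms by (rule has_derivative_inner)
  then have "((\<lambda>y. F y \<bullet> G y) has_derivative (\<lambda>h. grad (\<lambda>y. F y \<bullet> G y) x \<bullet> h)) (at x)"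
    by (intro has_derivative_grad) (auto simp: differentiable_def)
  from has_derivative_unique[OF this d] show ?thesis
    by (metis add.commute)
qed

text \<open>Apart from the Laplacians, the second derivatives of \<open>f\<close> and \<open>g\<close> enter the divergence of the
  first two terms of the field through \<open>x \<bullet> (D\<^sup>2f \<nabla>g + D\<^sup>2g \<nabla>f)\<close>, which is \<open>x \<bullet> \<nabla>(\<nabla>f \<bullet> \<nabla>g)\<close>. The last
  term of the field removes it, and turns \<open>2 \<nabla>f \<bullet> \<nabla>g\<close> into \<open>(2 - n) \<nabla>f \<bullet> \<nabla>g\<close>.\<close>

lemma divergence_pohozaev_field:
  fixes f g :: "real^'n \<Rightarrow> real"
  assumes f: "Ck_on 2 S f" and g: "Ck_on 2 S g" and S: "open S" "x \<in> S"
  shows "divergence (pohozaev_field (grad f) (grad g)) x =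
    (2 - real CARD('n)) * (grad f x \<bullet> grad g x)
    + (x \<bullet> grad f x) * laplacian g x + (x \<bullet> grad g x) * laplacian f x"
proof -
  note df = has_derivative_grad_hess[OF f S(2)] and dg = has_derivative_grad_hess[OF g S(2)]
  note di = has_derivative_ident[of "at x"]
  note inner = grad_inner_dot[OF di df] grad_inner_dot[OF di dg] grad_inner_dot[OF df dg]
  have [simp]: "grad f differentiable (at x)" "grad g differentiable (at x)"
    using df dg by (auto simp: differentiable_def)
  have [simp]: "(\<lambda>y. y \<bullet> grad f y) differentiable (at x)" "(\<lambda>y. y \<bullet> grad g y) differentiable (at x)"
      "(\<lambda>y. grad f y \<bullet> grad g y) differentiable (at x)"
    using has_derivative_inner[OF di df] has_derivative_inner[OF di dg] has_derivative_inner[OF df dg]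
    by (auto simp: differentiable_def)
  show ?thesis
    unfolding pohozaev_field_def
    by (simp add: divergence_add divergence_diff divergence_scaleR divergence_ident divergence_grad
        inner hess_symmetric[OF f S, of x] hess_symmetric[OF g S, of x] inner_commute[of _ "hess _ _ _"]
        inner_commute[of "grad g x" "grad f x"] algebra_simps)
qed

section \<open>The Hamiltonian along a solution\<close>

text \<open>The total derivative of \<open>H\<close> splits over the three arguments by linearity, and the value on
  each basis vector is a partial derivative.\<close>

lemma has_derivative_D_xuv:
  fixes H :: "(real^'n) \<times> (real^'m) \<times> (real^'m) \<Rightarrow> real"
  assumes "H differentiable (at z)"
  shows "(H has_derivative (\<lambda>(h, p, q). (\<Sum>i\<in>UNIV. h $ i * D_x i H z)
    + (\<Sum>k\<in>UNIV. p $ k * D_u k H z + q $ k * D_v k H z))) (at z)"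
proof -
  obtain H' where H': "(H has_derivative H') (at z)"
    using assms by (auto simp: differentiable_def)
  then have lin: "linear H'" by (rule has_derivative_linear)
  have "H' (h, p, q) = (\<Sum>i\<in>UNIV. h $ i * D_x i H z)
    + (\<Sum>k\<in>UNIV. p $ k * D_u k H z + q $ k * D_v k H z)" for h p q
  proof -
    have lins: "linear (\<lambda>h. H' (h, 0, 0))" "linear (\<lambda>p. H' (0, p, 0))" "linear (\<lambda>q. H' (0, 0, q))"
      by (intro linear_compose[OF _ lin, unfolded o_def] linearI; simp)+
    have "H' (h, p, q) = H' ((h, 0, 0) + (0, p, 0) + (0, 0, q))" by simp
    also have "\<dots> = H' (h, 0, 0) + H' (0, p, 0) + H' (0, 0, q)"
      by (simp only: linear_add[OF lin])
    finally show ?thesis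
      using linear_vec_expansion[OF lins(1), of h] linear_vec_expansion[OF lins(2), of p]
        linear_vec_expansion[OF lins(3), of q]
      by (simp add: D_x_def D_u_def D_v_def partial_eq[OF H'] sum.distrib)
  qed
  then have "H' = (\<lambda>(h, p, q). (\<Sum>i\<in>UNIV. h $ i * D_x i H z)
    + (\<Sum>k\<in>UNIV. p $ k * D_u k H z + q $ k * D_v k H z))" by auto
  with H' show ?thesis by simp
qed

lemma has_derivative_vec_lambda_grad:
  assumes "\<And>k. w k differentiable (at x)"
  shows "((\<lambda>y. \<chi> k. w k y) has_derivative (\<lambda>h. \<chi> k. grad (w k) x \<bullet> h)) (at x)"
proof -
  have "((\<lambda>y. (\<chi> k. w k y) \<bullet> b) has_derivative (\<lambda>h. (\<chi> k. grad (w k) x \<bullet> h) \<bullet> b)) (at x)"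
    if Basis: "b \<in> Basis" for b
  proof -
    obtain k where "b = axis k 1" using Basis unfolding Basis_vec_def by auto
    then show ?thesis
      using has_derivative_grad[OF assms, of k] by (simp add: inner_axis)
  qed
  then show ?thesis by (subst has_derivative_componentwise_within) simp
qed

text \<open>The chain rule separates the explicit dependence of \<open>H\<close> on \<open>x\<close>, the only part seen by
  \<open>D_x\<close>, from the dependence through the solution.\<close>

lemma has_derivative_H_state:
  assumes "H differentiable (at (state u v x))"
    and "\<And>k. u k differentiable (at x)" "\<And>k. v k differentiable (at x)"
  shows "((\<lambda>y. H (state u v y)) has_derivative (\<lambda>h. (\<Sum>i\<in>UNIV. h $ i * D_x i H (state u v x))
    + (\<Sum>k\<in>UNIV. (grad (u k) x \<bullet> h) * D_u k H (state u v x)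
               + (grad (v k) x \<bullet> h) * D_v k H (state u v x)))) (at x)"
proof -
  have "(state u v has_derivative
      (\<lambda>h. (h, (\<chi> k. grad (u k) x \<bullet> h), (\<chi> k. grad (v k) x \<bullet> h)))) (at x)"
    unfolding state_def
    by (intro has_derivative_Pair has_derivative_ident has_derivative_vec_lambda_grad assms)
  from has_derivative_compose[OF this has_derivative_D_xuv[OF assms(1)]]
  show ?thesis by simp
qed

lemma continuous_on_state:
  assumes "\<And>k. continuous_on S (u k)" "\<And>k. continuous_on S (v k)"
  shows "continuous_on S (state u v)"
  unfolding state_def by (intro continuous_intros assms)

lemma Ck_1_H_state:
  fixes H :: "(real^'n) \<times> (real^'m) \<times> (real^'m) \<Rightarrow> real"
  assumes H: "Ck_on 1 T H" and ST: "state u v ` S \<subseteq> T"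
    and u: "\<And>k. Ck_on 1 S (u k)" and v: "\<And>k. Ck_on 1 S (v k)"
  shows "Ck_on 1 S (\<lambda>x. H (state u v x))"
proof (rule Ck_1I)
  fix x assume x: "x \<in> S"
  show "((\<lambda>y. H (state u v y)) has_derivative (\<lambda>h. (\<Sum>i\<in>UNIV. h $ i * D_x i H (state u v x))
    + (\<Sum>k\<in>UNIV. (grad (u k) x \<bullet> h) * D_u k H (state u v x)
               + (grad (v k) x \<bullet> h) * D_v k H (state u v x)))) (at x)"
    using x ST H u v unfolding Ck_1_iff by (intro has_derivative_H_state) blast+
next
  have cs: "continuous_on S (state u v)"
    using u v by (intro continuous_on_state Ck_1_continuous)
  have comp: "continuous_on S (\<lambda>x. partial b H (state u v x))" if "b \<in> Basis" for b
    using H that ST unfolding Ck_1_iff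
    by (intro continuous_on_compose2[OF _ cs, of T]) auto
  have D: "continuous_on S (\<lambda>x. D_x i H (state u v x))"
    "continuous_on S (\<lambda>x. D_u k H (state u v x))"
    "continuous_on S (\<lambda>x. D_v k H (state u v x))" for i k
    unfolding D_x_def D_u_def D_v_def by (intro comp; simp add: Basis_prod_def zero_prod_def image_iff)+
  have gr: "continuous_on S (grad w)" if "Ck_on 1 S w" for w :: "real^'n \<Rightarrow> real"
    unfolding grad_def[abs_def] using that by (intro continuous_intros) (auto simp: Ck_1_iff)
  show "continuous_on S (\<lambda>x. (\<Sum>i\<in>UNIV. b $ i * D_x i H (state u v x))
    + (\<Sum>k\<in>UNIV. (grad (u k) x \<bullet> b) * D_u k H (state u v x)
               + (grad (v k) x \<bullet> b) * D_v k H (state u v x)))" for b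
    by (intro continuous_intros D gr u v)
qed

section \<open>Gradients at the boundary\<close>

text \<open>Directions orthogonal to \<open>n\<close> are limits of directions in the half-space and come in opposite
  pairs, so \<open>w\<close> is orthogonal to all of them; the direction \<open>- n\<close> then fixes the sign.\<close>

lemma eq_neg_norm_scaleR_if_nonneg_on_halfspace:
  fixes w n :: "'a::real_inner"
  assumes n: "norm n = 1" and w: "\<And>d. d \<bullet> n < 0 \<Longrightarrow> 0 \<le> w \<bullet> d"
  shows "w = - norm w *\<^sub>R n"
proof -
  have nn: "n \<bullet> n = 1" using n by (simp add: dot_square_norm)
  define c where "c = - (w \<bullet> n)"
  have c: "c \<ge> 0" using w[of "- n"] by (simp add: nn c_def)
  \<comment> \<open>The part of \<open>w\<close> orthogonal to \<open>n\<close>. Testing with \<open>- t\<close> would make it vanish, but \<open>- t\<close> lies only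
    on the edge of the half-space, so it is pushed inside by the multiple \<open>e\<close> of \<open>- n\<close>, where
    \<open>e\<close> is so small that \<open>e * c < t \<bullet> t\<close>.\<close>
  define t where "t = w + c *\<^sub>R n"
  have tn: "t \<bullet> n = 0" by (simp add: t_def c_def inner_add_left inner_diff_left nn)
  have "t \<bullet> t = w \<bullet> t + c * (n \<bullet> t)"
    by (metis t_def inner_add_left inner_scaleR_left)
  then have wt: "w \<bullet> t = t \<bullet> t" using tn by (simp add: inner_commute)
  define e where "e = (t \<bullet> t) / (c + 1)"
  have "t = 0"
  proof (rule ccontr)
    assume "t \<noteq> 0"
    then have e: "e > 0" using c by (simp add: e_def)
    have "0 \<le> w \<bullet> (- t - e *\<^sub>R n)"
      using e by (intro w) (simp add: inner_diff_left tn nn)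
    then have "t \<bullet> t \<le> e * c" by (simp add: inner_diff_right wt c_def)
    also have "e * c < e * (c + 1)" using e by simp
    also have "\<dots> = t \<bullet> t" using c by (simp add: e_def)
    finally show False by simp
  qed
  then have w_eq: "w = - c *\<^sub>R n" by (simp add: t_def eq_neg_iff_add_eq_0)
  then have "norm w = c" using c n by simp
  with w_eq show ?thesis by simp
qed

text \<open>Along each ray from \<open>p\<close> into \<open>\<Omega>\<close> the function rises from \<open>0\<close> to positive values, so its slope
  cannot be negative throughout an initial segment. By continuity the extended gradient has a nonnegative
  product with every inward direction. Working with rays avoids differentiating \<open>f\<close> along curves
  within the boundary: tangential directions are reached as limits of inward ones.\<close>

lemma extended_grad_at_boundary:
  fixes \<Omega> :: "(real^'n) set"
  assumes p: "p \<in> frontier \<Omega>" and \<nu>: "outward_unit_normal \<Omega> p n"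
    and df: "\<And>x. x \<in> \<Omega> \<Longrightarrow> f differentiable (at x)"
    and cf: "continuous_on (closure \<Omega>) f"
    and cg: "continuous_on (closure \<Omega>) g" and g: "\<And>x. x \<in> \<Omega> \<Longrightarrow> g x = grad f x"
    and fp: "f p = 0" and pos: "\<And>x. x \<in> \<Omega> \<Longrightarrow> f x > 0"
  shows "g p = - norm (g p) *\<^sub>R n"
proof (rule eq_neg_norm_scaleR_if_nonneg_on_halfspace)
  show "norm n = 1" using \<nu> by (simp add: outward_unit_normal_def)
next
  fix d assume d: "d \<bullet> n < 0"
  have pc: "p \<in> closure \<Omega>" using p by (simp add: frontier_def)
  have sub: "\<Omega> \<subseteq> closure \<Omega>" by (rule closure_subset)
  have ray: "\<forall>\<^sub>F t in at_right 0. p + t *\<^sub>R d \<in> \<Omega>"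
    using \<nu> d by (simp add: outward_unit_normal_def)
  show "0 \<le> g p \<bullet> d"
  proof (rule ccontr)
    assume neg: "\<not> 0 \<le> g p \<bullet> d"
    have "((\<lambda>t. p + t *\<^sub>R d) \<longlongrightarrow> p + 0 *\<^sub>R d) (at_right 0)"
      by (intro tendsto_intros)
    then have "((\<lambda>t. g (p + t *\<^sub>R d)) \<longlongrightarrow> g p) (at_right 0)"
      using pc ray sub by (intro continuous_on_tendsto_compose[OF cg]) (auto elim: eventually_mono)
    then have "((\<lambda>t. g (p + t *\<^sub>R d) \<bullet> d) \<longlongrightarrow> g p \<bullet> d) (at_right 0)"
      by (intro tendsto_intros)
    then have "\<forall>\<^sub>F t in at_right 0. g (p + t *\<^sub>R d) \<bullet> d < 0"
      using neg by (intro order_tendstoD) auto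
    with ray have "\<forall>\<^sub>F t in at_right 0. p + t *\<^sub>R d \<in> \<Omega> \<and> g (p + t *\<^sub>R d) \<bullet> d < 0"
      by (rule eventually_conj)
    then obtain r where r: "r > 0"
      "\<And>t. 0 < t \<Longrightarrow> t < r \<Longrightarrow> p + t *\<^sub>R d \<in> \<Omega> \<and> g (p + t *\<^sub>R d) \<bullet> d < 0"
      unfolding eventually_at_right_field by auto
    define s where "s = r / 2"
    have s: "0 < s" "s < r" using r(1) by (auto simp: s_def)
    have "f (p + s *\<^sub>R d) < f (p + 0 *\<^sub>R d)"
    proof (rule DERIV_neg_imp_decreasing_open[OF s(1)])
      fix t assume t: "0 < t" "t < s"
      then have tr: "p + t *\<^sub>R d \<in> \<Omega>" "g (p + t *\<^sub>R d) \<bullet> d < 0" using r(2) s by auto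
      have "partial d f (p + t *\<^sub>R d) = g (p + t *\<^sub>R d) \<bullet> d"
        using partial_eq[OF has_derivative_grad[OF df[OF tr(1)]]] g[OF tr(1)] by simp
      with tr DERIV_along_line[OF df[OF tr(1)]]
      show "\<exists>y. ((\<lambda>t. f (p + t *\<^sub>R d)) has_real_derivative y) (at t) \<and> y < 0" by auto
    next
      have "p + t *\<^sub>R d \<in> closure \<Omega>" if "t \<in> {0..s}" for t
        using that r(2)[of t] s pc sub by (cases "t = 0") auto
      then show "continuous_on {0..s} (\<lambda>t. f (p + t *\<^sub>R d))"
        by (intro continuous_on_compose2[OF cf] continuous_intros) auto
    qed
    with fp pos[of "p + s *\<^sub>R d"] r(2)[OF s] show False by simp
  qed
qed

text \<open>The limit that defines the boundary gradient is taken within \<open>\<Omega>\<close>, where \<open>g\<close> and the gradient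
  agree, and boundary points of an open set are limit points of it.\<close>

lemma boundary_grad_eq:
  assumes "open \<Omega>" "x \<in> frontier \<Omega>"
    and "continuous_on (closure \<Omega>) g" "\<And>y. y \<in> \<Omega> \<Longrightarrow> g y = grad f y"
  shows "boundary_grad \<Omega> f x = g x"
  unfolding boundary_grad_def
proof (rule tendsto_Lim)
  have x: "x \<in> closure \<Omega>" "x \<notin> \<Omega>"
    using assms(1,2) by (auto simp: frontier_def interior_open)
  then show "\<not> trivial_limit (at x within \<Omega>)"
    by (auto simp: trivial_limit_within closure_def)
  have "(g \<longlongrightarrow> g x) (at x within \<Omega>)"
    using assms(3) x(1) tendsto_within_subset[OF _ closure_subset]
    unfolding continuous_on_def by blast
  then show "(grad f \<longlongrightarrow> g x) (at x within \<Omega>)"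
    using assms(4) by (auto elim!: Lim_transform_eventually simp: eventually_at_filter)
qed

section \<open>Integrability over the boundary\<close>

lemma sets_surface_measure: "sets surface_measure = sets borel"
  unfolding surface_measure_def hausdorff_measure_def
  using sets.sigma_sets_eq[of borel] by (subst sets_measure_of) auto

text \<open>Integrability over the boundary is extracted from the divergence theorem itself. The Bochner
  integral of a function that is not integrable is \<open>0\<close>; but for the field \<open>x - b\<close> the theorem gives
  \<open>n\<close> times the volume of \<open>\<Omega>\<close>, which is positive. Subtracting two such fields leaves a constant
  one.\<close>

lemma set_integrable_normal_component:
  fixes \<Omega> :: "(real^'n) set"
  assumes \<Omega>: "open \<Omega>" "\<Omega> \<noteq> {}" "bounded \<Omega>" and div: "divergence_theorem_holds \<Omega> \<nu>"
  shows "set_integrable surface_measure (frontier \<Omega>) (\<lambda>x. c \<bullet> \<nu> x)"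
proof -
  have fin: "emeasure lborel \<Omega> < \<infinity>" using \<Omega>(3) by (rule emeasure_bounded_finite)
  have pos: "0 < measure lborel \<Omega>"
  proof -
    obtain x r where r: "0 < r" "ball x r \<subseteq> \<Omega>"
      using \<Omega>(1,2) by (meson ex_in_conv open_contains_ball)
    have "0 < measure lborel (ball x r)" using r(1) by (simp add: content_ball_pos)
    also have "\<dots> \<le> measure lborel \<Omega>"
      using r(2) fin \<Omega>(1) by (intro measure_mono_fmeasurable) (auto simp: fmeasurable_def)
    finally show ?thesis .
  qed
  have int: "set_integrable surface_measure (frontier \<Omega>) (\<lambda>x. (x - b) \<bullet> \<nu> x)" for b
  proof (rule ccontr)
    assume "\<not> set_integrable surface_measure (frontier \<Omega>) (\<lambda>x. (x - b) \<bullet> \<nu> x)"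
    then have "(LINT x:frontier \<Omega>|surface_measure. (x - b) \<bullet> \<nu> x) = 0"
      unfolding set_integrable_def set_lebesgue_integral_def by (rule not_integrable_integral_eq)
    moreover have "(LINT x:\<Omega>|lborel. divergence (\<lambda>y. y - b) x) =
        (LINT x:frontier \<Omega>|surface_measure. (x - b) \<bullet> \<nu> x)"
    proof (rule div[unfolded divergence_theorem_holds_def, rule_format], intro conjI allI)
      show "continuous_on (closure \<Omega>) (\<lambda>y. y - b)" by (intro continuous_intros)
      show "Ck_on 1 \<Omega> (\<lambda>y. (y - b) $ i)" for i
        unfolding vector_minus_component by (intro Ck_1_intros)
      show "set_integrable lborel \<Omega> (divergence (\<lambda>y. y - b))"
        using fin \<Omega>(1) by (simp add: divergence_ident_diff set_integrable_def)
    qed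
    moreover have "(LINT x:\<Omega>|lborel. divergence (\<lambda>y. y - b) x) = measure lborel \<Omega> * real CARD('n)"
      using fin \<Omega>(1) by (simp add: divergence_ident_diff set_lebesgue_integral_def)
    ultimately show False using pos by simp
  qed
  have "set_integrable surface_measure (frontier \<Omega>) (\<lambda>x. (x - 0) \<bullet> \<nu> x - (x - c) \<bullet> \<nu> x)"
    by (intro set_integral_diff int)
  then show ?thesis by (simp add: inner_diff_left)
qed

text \<open>A continuous field is bounded on the compact boundary, and its flux density is a combination of
  the integrable components of the normal with bounded measurable coefficients. The individual
  boundary integrals of the Pohozaev identity are of this type, and their integrability allows the
  integral of the sum over \<open>k\<close> to be split.\<close>

lemma set_integrable_continuous_flux:
  fixes \<Omega> :: "(real^'n) set"
  assumes \<Omega>: "open \<Omega>" "\<Omega> \<noteq> {}" "bounded \<Omega>" and div: "divergence_theorem_holds \<Omega> \<nu>"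
    and F: "continuous_on (frontier \<Omega>) F"
  shows "set_integrable surface_measure (frontier \<Omega>) (\<lambda>x. F x \<bullet> \<nu> x)"
proof -
  let ?I = "indicator (frontier \<Omega>) :: real^'n \<Rightarrow> real"
  have comp: "compact (frontier \<Omega>)"
    using \<Omega>(3) by (rule compact_frontier_bounded)
  have "set_integrable surface_measure (frontier \<Omega>) (\<lambda>x. F x $ i * (axis i 1 \<bullet> \<nu> x))" for i
  proof -
    have ci: "continuous_on (frontier \<Omega>) (\<lambda>x. F x $ i)" by (intro continuous_intros F)
    then have "bounded ((\<lambda>x. F x $ i) ` frontier \<Omega>)"
      using comp compact_continuous_image compact_imp_bounded by blast
    then obtain B where B: "\<And>x. x \<in> frontier \<Omega> \<Longrightarrow> \<bar>F x $ i\<bar> \<le> B"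
      unfolding bounded_iff by auto
    have int: "integrable surface_measure (\<lambda>x. ?I x *\<^sub>R (axis i 1 \<bullet> \<nu> x))"
      using set_integrable_normal_component[OF \<Omega> div] unfolding set_integrable_def .
    have "(\<lambda>x. ?I x *\<^sub>R (F x $ i)) \<in> borel_measurable borel"
      using ci by (intro borel_measurable_continuous_on_indicator) auto
    then have meas: "(\<lambda>x. ?I x *\<^sub>R (F x $ i)) \<in> borel_measurable surface_measure"
      using measurable_cong_sets[OF sets_surface_measure refl] by blast
    have "integrable surface_measure (\<lambda>x. (?I x *\<^sub>R (F x $ i)) * (?I x *\<^sub>R (axis i 1 \<bullet> \<nu> x)))"
    proof (rule Bochner_Integration.integrable_bound)
      show "integrable surface_measure (\<lambda>x. B * (?I x *\<^sub>R (axis i 1 \<bullet> \<nu> x)))"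
        using int by (rule integrable_mult_right)
      show "AE x in surface_measure. norm ((?I x *\<^sub>R (F x $ i)) * (?I x *\<^sub>R (axis i 1 \<bullet> \<nu> x)))
          \<le> norm (B * (?I x *\<^sub>R (axis i 1 \<bullet> \<nu> x)))"
        using B by (intro AE_I2)
          (auto simp: indicator_def abs_mult intro!: mult_right_mono intro: order_trans[OF _ abs_ge_self])
    qed (use meas int in measurable)
    then show ?thesis
      unfolding set_integrable_def by (rule back_subst[of "integrable _"]) (auto simp: indicator_def)
  qed
  then have "set_integrable surface_measure (frontier \<Omega>)
      (\<lambda>x. \<Sum>i\<in>UNIV. F x $ i * (axis i 1 \<bullet> \<nu> x))"
    unfolding set_integrable_def scaleR_sum_right by (intro Bochner_Integration.integrable_sum)
  then show ?thesis by (simp add: inner_vec_def[of "F _"] inner_axis')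
qed

section \<open>The Pohozaev identity for Hamiltonian systems\<close>

lemma Ck_1_grad_nth:
  assumes "Ck_on 2 S f"
  shows "Ck_on 1 S (\<lambda>x. grad f x $ i)"
  using assms by (simp add: grad_def Ck_2_iff del: One_nat_def)

text \<open>The field whose flux is computed. The weights \<open>a k\<close> and \<open>2 - a k\<close> add up to \<open>2\<close>, so for every
  choice of \<open>a\<close> the second sum contributes the same multiple of \<open>\<nabla>u\<^sub>k \<bullet> \<nabla>v\<^sub>k\<close>, the one that cancels
  the contribution of the Pohozaev fields.\<close>

definition hamiltonian_field :: "((real^'n) \<times> (real^'m) \<times> (real^'m) \<Rightarrow> real) \<Rightarrow> ('m::finite \<Rightarrow> real)
    \<Rightarrow> ('m \<Rightarrow> real^'n \<Rightarrow> real) \<Rightarrow> ('m \<Rightarrow> real^'n \<Rightarrow> real)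
    \<Rightarrow> ('m \<Rightarrow> real^'n \<Rightarrow> real^'n) \<Rightarrow> ('m \<Rightarrow> real^'n \<Rightarrow> real^'n) \<Rightarrow> real^'n \<Rightarrow> real^'n" where
  "hamiltonian_field H a u v G K x =
     2 *\<^sub>R ((\<Sum>k\<in>UNIV. pohozaev_field (G k) (K k) x) + H (state u v x) *\<^sub>R x)
     - (2 - real CARD('n)) *\<^sub>R
         (\<Sum>k\<in>UNIV. (a k * u k x) *\<^sub>R K k x + ((2 - a k) * v k x) *\<^sub>R G k x)"

lemma hamiltonian_field_cong:
  assumes "\<And>k. G k x = G' k x" "\<And>k. K k x = K' k x"
  shows "hamiltonian_field H a u v G K x = hamiltonian_field H a u v G' K' x"
  by (simp add: hamiltonian_field_def pohozaev_field_def assms)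

lemma differentiable_grad:
  assumes "Ck_on 2 S f" "x \<in> S"
  shows "grad f differentiable (at x)"
  using has_derivative_grad_hess[OF assms] by (auto simp: differentiable_def)

lemma differentiable_pohozaev_field:
  assumes "G differentiable (at x)" "K differentiable (at x)"
  shows "pohozaev_field G K differentiable (at x)"
proof -
  have "(\<lambda>y. A y \<bullet> B y) differentiable (at x)"
    if "A differentiable (at x)" "B differentiable (at x)" for A B :: "real^'a \<Rightarrow> real^'a"
    using that has_derivative_inner unfolding differentiable_def by blast
  with assms show ?thesis
    unfolding pohozaev_field_def by (intro differentiable_add differentiable_diff differentiable_scaleR) auto
qed

text \<open>The derivatives of \<open>H\<close> through the solution, which come from \<open>H x\<close>, cancel against
  \<open>(x \<bullet> \<nabla>u\<^sub>k) \<Delta>v\<^sub>k + (x \<bullet> \<nabla>v\<^sub>k) \<Delta>u\<^sub>k\<close> by the equations. Of the doubled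
  part of the field \<open>2 n H + 2 x \<bullet> H\<^sub>x + 2 (2 - n) \<Sum>\<^sub>k \<nabla>u\<^sub>k \<bullet> \<nabla>v\<^sub>k\<close> remains, and the other part exchanges
  the last term for products of the solution with derivatives of \<open>H\<close>.\<close>

lemma divergence_hamiltonian_field:
  fixes \<Omega> :: "(real^'n) set" and u v :: "'m::finite \<Rightarrow> real^'n \<Rightarrow> real"
  assumes \<Omega>: "open \<Omega>" "x \<in> \<Omega>"
    and u: "\<And>k. Ck_on 2 \<Omega> (u k)" and v: "\<And>k. Ck_on 2 \<Omega> (v k)"
    and H: "H differentiable (at (state u v x))"
    and equ: "\<And>k. laplacian (u k) x + D_v k H (state u v x) = 0"
    and eqv: "\<And>k. laplacian (v k) x + D_u k H (state u v x) = 0"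
  shows "divergence (hamiltonian_field H a u v (\<lambda>k. grad (u k)) (\<lambda>k. grad (v k))) x =
    2 * real CARD('n) * H (state u v x)
    + (2 - real CARD('n)) * (\<Sum>k\<in>UNIV. a k * u k x * D_u k H (state u v x)
                                 + (2 - a k) * v k x * D_v k H (state u v x))
    + 2 * (\<Sum>i\<in>UNIV. x $ i * D_x i H (state u v x))"
proof -
  let ?N = "real CARD('n)" and ?z = "state u v x"
  have lap: "laplacian (u k) x = - D_v k H ?z" "laplacian (v k) x = - D_u k H ?z" for k
    using equ[of k] eqv[of k] by auto
  have du: "u k differentiable (at x)" and dv: "v k differentiable (at x)" for k
    using u v \<Omega> unfolding Ck_2_iff by blast+
  have dgu: "grad (u k) differentiable (at x)" and dgv: "grad (v k) differentiable (at x)" for k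
    using differentiable_grad u v \<Omega> by blast+
  note dH = has_derivative_H_state[of H u v x, OF H du dv]
  have dHd: "(\<lambda>y. H (state u v y)) differentiable (at x)"
    using dH by (auto simp: differentiable_def)
  have divHx: "divergence (\<lambda>y. H (state u v y) *\<^sub>R y) x =
      ?N * H ?z + (\<Sum>i\<in>UNIV. x $ i * D_x i H ?z)
      + (\<Sum>k\<in>UNIV. (x \<bullet> grad (u k) x) * D_u k H ?z + (x \<bullet> grad (v k) x) * D_v k H ?z)"
    using has_derivative_unique[OF has_derivative_grad[OF dHd] dH, THEN fun_cong, of x]
    by (simp add: divergence_scaleR dHd divergence_ident inner_commute[of x "grad _ x"])
  have divP: "divergence (\<lambda>y. \<Sum>k\<in>UNIV. pohozaev_field (grad (u k)) (grad (v k)) y) x =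
      (2 - ?N) * (\<Sum>k\<in>UNIV. grad (u k) x \<bullet> grad (v k) x)
      - (\<Sum>k\<in>UNIV. (x \<bullet> grad (u k) x) * D_u k H ?z + (x \<bullet> grad (v k) x) * D_v k H ?z)"
    by (simp add: divergence_sum differentiable_pohozaev_field dgu dgv lap
        divergence_pohozaev_field[OF u v \<Omega>] sum_distrib_left sum.distrib sum_subtractf algebra_simps)
  have dau: "(\<lambda>y. (a k * u k y)) differentiable (at x)" and dav: "(\<lambda>y. ((2 - a k) * v k y)) differentiable (at x)" for k
    by (intro differentiable_mult differentiable_const du dv)+
  have gau: "grad (\<lambda>y. a k * u k y) x = a k *\<^sub>R grad (u k) x"
    and gav: "grad (\<lambda>y. (2 - a k) * v k y) x = (2 - a k) *\<^sub>R grad (v k) x" for k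
    using grad_eq[OF has_derivative_mult_right[OF has_derivative_grad[OF du]]]
      grad_eq[OF has_derivative_mult_right[OF has_derivative_grad[OF dv]]]
    by (simp_all add: vec_eq_iff inner_axis)
  have dQ: "(\<lambda>y. (a k * u k y) *\<^sub>R grad (v k) y + ((2 - a k) * v k y) *\<^sub>R grad (u k) y)
      differentiable (at x)" for k
    by (intro differentiable_add differentiable_scaleR dau dav dgu dgv)
  have divQk: "divergence (\<lambda>y. (a k * u k y) *\<^sub>R grad (v k) y + ((2 - a k) * v k y) *\<^sub>R grad (u k) y) x
     = 2 * (grad (u k) x \<bullet> grad (v k) x)
      - (a k * u k x * D_u k H ?z + (2 - a k) * v k x * D_v k H ?z)" for k
    unfolding divergence_add[OF differentiable_scaleR[OF dau dgv] differentiable_scaleR[OF dav dgu]]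
      divergence_scaleR[OF dau dgv] divergence_scaleR[OF dav dgu] divergence_grad lap gau gav
    by (simp add: inner_commute[of "grad (v k) x"] algebra_simps)
  have divQ: "divergence (\<lambda>y. \<Sum>k\<in>UNIV. (a k * u k y) *\<^sub>R grad (v k) y + ((2 - a k) * v k y) *\<^sub>R grad (u k) y) x
     = 2 * (\<Sum>k\<in>UNIV. grad (u k) x \<bullet> grad (v k) x)
      - (\<Sum>k\<in>UNIV. a k * u k x * D_u k H ?z + (2 - a k) * v k x * D_v k H ?z)"
    by (subst divergence_sum[OF dQ]) (simp only: divQk sum_subtractf sum_distrib_left)
  have dP: "(\<lambda>y. \<Sum>k\<in>UNIV. pohozaev_field (grad (u k)) (grad (v k)) y) differentiable (at x)"
    by (intro differentiable_sum) (auto intro: differentiable_pohozaev_field dgu dgv)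
  have dHx: "(\<lambda>y. H (state u v y) *\<^sub>R y) differentiable (at x)"
    by (intro differentiable_scaleR dHd differentiable_ident)
  have dQs: "(\<lambda>y. \<Sum>k\<in>UNIV. (a k * u k y) *\<^sub>R grad (v k) y + ((2 - a k) * v k y) *\<^sub>R grad (u k) y)
      differentiable (at x)"
    by (intro differentiable_sum ballI dQ finite)
  have dS: "(\<lambda>y. c *\<^sub>R F y) differentiable (at x)" if "F differentiable (at x)" for c and F :: "real^'n \<Rightarrow> real^'n"
    by (intro differentiable_scaleR differentiable_const that)
  show ?thesis
    unfolding hamiltonian_field_def[abs_def]
    by (simp only: divergence_diff[OF dS[OF differentiable_add[OF dP dHx]] dS[OF dQs]]
        divergence_const_scaleR[OF differentiable_add[OF dP dHx]] divergence_const_scaleR[OF dQs]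
        divergence_add[OF dP dHx] divHx divP divQ)
      (simp add: algebra_simps)
qed

lemma Ck_1_hamiltonian_field:
  assumes "Ck_on 1 S (\<lambda>x. H (state u v x))"
    and "\<And>k. Ck_on 2 S (u k)" "\<And>k. Ck_on 2 S (v k)"
  shows "Ck_on 1 S (\<lambda>x. hamiltonian_field H a u v (\<lambda>k. grad (u k)) (\<lambda>k. grad (v k)) x $ i)"
  unfolding hamiltonian_field_def pohozaev_field_def
    vector_minus_component vector_add_component vector_scaleR_component sum_component
    real_scaleR_def inner_vec_def inner_real_def
  by (intro Ck_1_intros Ck_1_grad_nth Ck_2_imp_1 assms)

lemma continuous_on_hamiltonian_field:
  assumes "continuous_on S (\<lambda>x. H (state u v x))"
    and "\<And>k. continuous_on S (u k)" "\<And>k. continuous_on S (v k)"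
    and "\<And>k. continuous_on S (G k)" "\<And>k. continuous_on S (K k)"
  shows "continuous_on S (hamiltonian_field H a u v G K)"
  unfolding hamiltonian_field_def[abs_def] pohozaev_field_def by (intro continuous_intros assms)

lemma pohozaev_field_dot_normal:
  assumes "n \<bullet> n = 1" "G x = - r *\<^sub>R n" "K x = - s *\<^sub>R n"
  shows "pohozaev_field G K x \<bullet> n = (x \<bullet> n) * r * s"
  by (simp add: pohozaev_field_def inner_diff_left inner_add_left assms)

text \<open>Where \<open>u\<close>, \<open>v\<close> and \<open>H\<close> vanish only the Pohozaev fields survive. When both gradients are
  antiparallel to the normal, the two signs in each product cancel, and the three terms of
  a Pohozaev field have the same size, with signs \<open>1 + 1 - 1\<close>.\<close>

lemma hamiltonian_field_dot_normal:
  assumes "\<And>k. u k x = 0" "\<And>k. v k x = 0" "H (x, 0, 0) = 0" and n: "norm n = 1"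
    and G: "\<And>k. G k x = - norm (G k x) *\<^sub>R n" and K: "\<And>k. K k x = - norm (K k x) *\<^sub>R n"
  shows "hamiltonian_field H a u v G K x \<bullet> n =
    2 * (\<Sum>k\<in>UNIV. (x \<bullet> n) * norm (G k x) * norm (K k x))"
proof -
  have z: "state u v x = (x, 0, 0)" by (simp add: state_def assms vec_eq_iff)
  have nn: "n \<bullet> n = 1" using n by (simp add: dot_square_norm)
  have "pohozaev_field (G k) (K k) x \<bullet> n = (x \<bullet> n) * norm (G k x) * norm (K k x)" for k
    by (rule pohozaev_field_dot_normal[OF nn, of "G k" x _ "K k", OF G K])
  then show ?thesis
    by (simp add: hamiltonian_field_def z assms(1-3) inner_sum_left)
qed

theorem theorem2p1:
  fixes \<Omega> :: "(real^'n) set"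
    and \<nu> :: "real^'n \<Rightarrow> real^'n"
    and H :: "(real^'n) \<times> (real^'m) \<times> (real^'m) \<Rightarrow> real"
    and u v :: "'m::finite \<Rightarrow> real^'n \<Rightarrow> real"
    and a :: "'m \<Rightarrow> real"
  assumes "open \<Omega>" "connected \<Omega>" "\<Omega> \<noteq> {}" "bounded \<Omega>"
    and "\<forall>x\<in>frontier \<Omega>. outward_unit_normal \<Omega> x (\<nu> x)"
    and "divergence_theorem_holds \<Omega> \<nu>"
    and "Ck_on 2 (\<Omega> \<times> positive_orthant \<times> positive_orthant) H"
    and "continuous_on (closure \<Omega> \<times> nonneg_orthant \<times> nonneg_orthant) H"
    and "\<forall>x\<in>frontier \<Omega>. H (x, 0, 0) = 0"
    and "classical_solution \<Omega> H u v"
    and "positive_on \<Omega> u v"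
    and "set_integrable lborel \<Omega> (\<lambda>x. 2 * real CARD('n) * H (state u v x)
           + (2 - real CARD('n)) * (\<Sum>k\<in>UNIV. a k * u k x * D_u k H (state u v x)
                                        + (2 - a k) * v k x * D_v k H (state u v x))
           + 2 * (\<Sum>i\<in>UNIV. x $ i * D_x i H (state u v x)))"
  shows "(LINT x:\<Omega>|lborel. 2 * real CARD('n) * H (state u v x)
           + (2 - real CARD('n)) * (\<Sum>k\<in>UNIV. a k * u k x * D_u k H (state u v x)
                                        + (2 - a k) * v k x * D_v k H (state u v x))
           + 2 * (\<Sum>i\<in>UNIV. x $ i * D_x i H (state u v x)))
       = 2 * (\<Sum>k\<in>UNIV. LINT x:frontier \<Omega>|surface_measure.
           (x \<bullet> \<nu> x) * norm (boundary_grad \<Omega> (u k) x) * norm (boundary_grad \<Omega> (v k) x))"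
    (is "(LINT x:\<Omega>|lborel. ?E x) = 2 * (\<Sum>k\<in>UNIV. LINT x:frontier \<Omega>|surface_measure. ?B k x)")
proof -
  note sol = \<open>classical_solution \<Omega> H u v\<close>[unfolded classical_solution_def C1_closure_def, rule_format]
  have u2: "Ck_on 2 \<Omega> (u k)" and v2: "Ck_on 2 \<Omega> (v k)"
    and uc: "continuous_on (closure \<Omega>) (u k)" and vc: "continuous_on (closure \<Omega>) (v k)" for k
    using sol by blast+
  have "\<exists>G. continuous_on (closure \<Omega>) G \<and> (\<forall>x\<in>\<Omega>. G x = grad (u k) x)"
    and "\<exists>K. continuous_on (closure \<Omega>) K \<and> (\<forall>x\<in>\<Omega>. K x = grad (v k) x)" for k
    using sol by blast+
  then obtain G K where Gc: "\<And>k. continuous_on (closure \<Omega>) (G k)"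
    and G: "\<And>k x. x \<in> \<Omega> \<Longrightarrow> G k x = grad (u k) x"
    and Kc: "\<And>k. continuous_on (closure \<Omega>) (K k)"
    and K: "\<And>k x. x \<in> \<Omega> \<Longrightarrow> K k x = grad (v k) x" by metis
  have u0: "u k x = 0" and v0: "v k x = 0" if "x \<in> frontier \<Omega>" for k x
    using sol that by blast+
  have pos: "u k x > 0" "v k x > 0" if "x \<in> \<Omega>" for k x
    using \<open>positive_on \<Omega> u v\<close> that by (auto simp: positive_on_def)
  have front_sub: "frontier \<Omega> \<subseteq> closure \<Omega>" by (simp add: frontier_def)
  have state_in: "state u v ` \<Omega> \<subseteq> \<Omega> \<times> positive_orthant \<times> positive_orthant"
    using pos by (auto simp: state_def positive_orthant_def)
  have nonneg: "0 \<le> u k x" "0 \<le> v k x" if "x \<in> closure \<Omega>" for k x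
  proof -
    have "x \<in> \<Omega> \<or> x \<in> frontier \<Omega>"
      using that \<open>open \<Omega>\<close> by (auto simp: frontier_def interior_open)
    then show "0 \<le> u k x" "0 \<le> v k x"
      using u0[of x k] v0[of x k] pos[of x k] by (metis less_imp_le order_refl)+
  qed
  have state_in': "state u v ` closure \<Omega> \<subseteq> closure \<Omega> \<times> nonneg_orthant \<times> nonneg_orthant"
    using nonneg by (auto simp: state_def nonneg_orthant_def)
  have H1: "Ck_on 1 (\<Omega> \<times> positive_orthant \<times> positive_orthant) H"
    using assms(7) by (rule Ck_2_imp_1)

  let ?Fgrad = "hamiltonian_field H a u v (\<lambda>k. grad (u k)) (\<lambda>k. grad (v k))"
  let ?F = "hamiltonian_field H a u v G K"
  have F0: "?Fgrad x = ?F x" if "x \<in> \<Omega>" for x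
    by (rule hamiltonian_field_cong) (simp_all add: G K that)
  have divF: "divergence ?F x = ?E x" if x: "x \<in> \<Omega>" for x
  proof -
    have "H differentiable (at (state u v x))"
      using H1 state_in x unfolding Ck_1_iff by blast
    then have "divergence ?Fgrad x = ?E x"
      using sol x by (intro divergence_hamiltonian_field[OF \<open>open \<Omega>\<close> x u2 v2]) auto
    then show ?thesis
      using divergence_cong_open[OF \<open>open \<Omega>\<close> x F0] by simp
  qed
  have Fc: "continuous_on (closure \<Omega>) ?F"
    using state_in' by (intro continuous_on_hamiltonian_field uc vc Gc Kc
        continuous_on_compose2[OF assms(8)] continuous_on_state)
  have "(LINT x:\<Omega>|lborel. ?E x) = (LINT x:\<Omega>|lborel. divergence ?F x)"
    using divF \<open>open \<Omega>\<close> by (intro set_lebesgue_integral_cong) auto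
  also have "\<dots> = (LINT x:frontier \<Omega>|surface_measure. ?F x \<bullet> \<nu> x)"
  proof (rule assms(6)[unfolded divergence_theorem_holds_def, rule_format], intro conjI allI Fc)
    show "Ck_on 1 \<Omega> (\<lambda>x. ?F x $ i)" for i
    proof (rule Ck_on_cong[OF \<open>open \<Omega>\<close>])
      show "Ck_on 1 \<Omega> (\<lambda>x. ?Fgrad x $ i)"
        by (intro Ck_1_hamiltonian_field Ck_1_H_state[OF H1 state_in] Ck_2_imp_1 u2 v2)
    qed (simp add: F0)
    show "set_integrable lborel \<Omega> (divergence ?F)"
      using assms(12) divF by (simp cong: set_integrable_cong)
  qed
  also have "\<dots> = (LINT x:frontier \<Omega>|surface_measure. 2 * (\<Sum>k\<in>UNIV. ?B k x))"
  proof -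
    have "?F x \<bullet> \<nu> x = 2 * (\<Sum>k\<in>UNIV. ?B k x)" if x: "x \<in> frontier \<Omega>" for x
    proof -
      have \<nu>: "outward_unit_normal \<Omega> x (\<nu> x)" using assms(5) x by blast
      have du: "u k differentiable (at y)" and dv: "v k differentiable (at y)" if "y \<in> \<Omega>" for k y
        using u2 v2 that unfolding Ck_2_iff by blast+
      have "?F x \<bullet> \<nu> x = 2 * (\<Sum>k\<in>UNIV. (x \<bullet> \<nu> x) * norm (G k x) * norm (K k x))"
      proof (rule hamiltonian_field_dot_normal)
        show "norm (\<nu> x) = 1" using \<nu> by (simp add: outward_unit_normal_def)
        show "H (x, 0, 0) = 0" using assms(9) x by blast
        show "G k x = - norm (G k x) *\<^sub>R \<nu> x" for k
          by (rule extended_grad_at_boundary[OF x \<nu> du uc Gc G u0[OF x] pos(1)])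
        show "K k x = - norm (K k x) *\<^sub>R \<nu> x" for k
          by (rule extended_grad_at_boundary[OF x \<nu> dv vc Kc K v0[OF x] pos(2)])
      qed (simp_all add: u0 v0 x)
      then show ?thesis
        using boundary_grad_eq[OF \<open>open \<Omega>\<close> x Gc G] boundary_grad_eq[OF \<open>open \<Omega>\<close> x Kc K] by simp
    qed
    then show ?thesis
      unfolding set_lebesgue_integral_def
      by (intro Bochner_Integration.integral_cong) (auto simp: indicator_def)
  qed
  also have "\<dots> = 2 * (\<Sum>k\<in>UNIV. LINT x:frontier \<Omega>|surface_measure. ?B k x)"
  proof -
    have "set_integrable surface_measure (frontier \<Omega>) (?B k)" for k
    proof -
      have "set_integrable surface_measure (frontier \<Omega>)
          (\<lambda>x. ((norm (G k x) * norm (K k x)) *\<^sub>R x) \<bullet> \<nu> x)"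
        using front_sub Gc Kc assms(1,3,4,6)
        by (intro set_integrable_continuous_flux continuous_intros)
          (auto intro: continuous_on_subset)
      moreover have eqB: "?B k x = ((norm (G k x) * norm (K k x)) *\<^sub>R x) \<bullet> \<nu> x"
        if x: "x \<in> frontier \<Omega>" for x
        using boundary_grad_eq[OF \<open>open \<Omega>\<close> x Gc G] boundary_grad_eq[OF \<open>open \<Omega>\<close> x Kc K] by simp
      ultimately show ?thesis by (subst set_integrable_cong[OF refl refl eqB])
    qed
    then have "(LINT x:frontier \<Omega>|surface_measure. \<Sum>k\<in>UNIV. ?B k x) =
        (\<Sum>k\<in>UNIV. LINT x:frontier \<Omega>|surface_measure. ?B k x)"
      unfolding set_lebesgue_integral_def set_integrable_def scaleR_sum_right
      by (intro Bochner_Integration.integral_sum)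
    then show ?thesis by (simp add: sum_distrib_left[symmetric])
  qed
  finally show ?thesis .
qed

end
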